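(* Let $X=\mathcal{P}_n$ be the space of real algebraic polynomials of degree $<n$, equipped with the supremum norm on $[-1,1]$, let $\mathcal{K}=\{f\in\mathcal{P}_n:\max_{x\in[-1,1]}|f(x)|\le 1\}$, let $\eta\ge0$ and $\mathcal{E}=\{e\in\mathbb{R}^m:\|e\|_\infty\le\eta\}$. Let $\ell_1,\ldots,\ell_m$ and $Q_1,\ldots,Q_K$ be linear functionals on $\mathcal{P}_n$, and set $L(f)=[\ell_1(f);\ldots;\ell_m(f)]\in\mathbb{R}^m$, $Q(f)=[Q_1(f);\ldots;Q_K(f)]\in\ell_\infty^K$. Define the $n\times n$ matrices $$C_k=\mathrm{Toep}[Q_k(T_0);Q_k(T_1);\ldots;Q_k(T_{n-1})],\qquad A_i=\mathrm{Toep}[\ell_i(T_0);\ell_i(T_1);\ldots;\ell_i(T_{n-1})],$$ for $k=1,\ldots,K$ and $i=1,\ldots,m$. Then a map $R:\mathbb{R}^m\to\ell_\infty^K$ whose value $R(y)$ at each $y\in L(\mathcal{K})+\mathcal{E}$ is the component $z\in\mathbb{R}^K$ of a solution to the semidefinite program $$\underset{\substack{z\in\mathbb{R}^K,\ r\in\mathbb{R}\\ x^{\pm,k}\in\mathbb{R}^n,\ u^{\pm,k},v^{\pm,k}\in\mathbb{R}^m}}{\text{minimize}}\ r$$ subject to, for both signs and all $k=1,\ldots,K$, $$x_1^{\pm,k}+\langle u^{\pm,k},y+\eta\rangle-\langle v^{\pm,k},y-\eta\rangle\le r\pm z_k,\qquad u^{\pm,k}\ge0,\quad v^{\pm,k}\ge0,$$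 $$\mathrm{Toep}(x^{\pm,k})\succeq+\Big(\pm C_k+\sum_{i=1}^m(v_i^{\pm,k}-u_i^{\pm,k})A_i\Big),\qquad \mathrm{Toep}(x^{\pm,k})\succeq-\Big(\pm C_k+\sum_{i=1}^m(v_i^{\pm,k}-u_i^{\pm,k})A_i\Big),$$ is locally optimal over $\mathcal{K}$ and $\mathcal{E}$ for the quantity of interest $Q$ at every $y\in L(\mathcal{K})+\mathcal{E}$.
   Context: $T_j$ is the Chebyshev polynomial of the first kind of degree $j$. For $x\in\mathbb{R}^d$, $\mathrm{Toep}(x)$ is the $d\times d$ symmetric Toeplitz matrix with $(i,j)$ entry $x_{|i-j|+1}$. $A\succeq B$ means that $A-B$ is positive semidefinite. Vector inequalities are componentwise; $y\pm\eta$ means adding $\pm\eta$ to every component; in expressions with superscripts $\pm,k$ the same sign is taken throughout (the signs $+$ and $-$ preceding the large parentheses are independent of it). $\ell_\infty^K$ is $\mathbb{R}^K$ with the max norm. For a model set $\mathcal{K}\subseteq X$, an uncertainty set $\mathcal{E}\subseteq\mathbb{R}^m$, a linear observation map $L:X\to\mathbb{R}^m$ and a linear map $Q:X\to Z$ into a normed space $Z$, a map $R:\mathbb{R}^m\to Z$ is called locally optimal over $\mathcal{K}$ and $\mathcal{E}$ at $y\in L(\mathcal{K})+\mathcal{E}$ if $$\sup_{\substack{f\in\mathcal{K},\,e\in\mathcal{E}\\ L(f)+e=y}}\|Q(f)-R(y)\|_Z=\inf_{w\in Z}\ \sup_{\substack{f\in\mathcal{K},\,e\in\mathcal{E}\\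 L(f)+e=y}}\|Q(f)-w\|_Z .$$ *)

theory Defs
  imports "HOL-Analysis.Analysis" "Jordan_Normal_Form.Matrix"
begin

text \<open>
  Two vector libraries are in use. The observation space and the space of quantities of interest
  are the types \<open>real ^ 'm\<close> and \<open>real ^ 'k\<close> of HOL-Analysis, with their componentwise order, inner
  product and max norm \<^const>\<open>infnorm\<close>; only for them is the infix dollar sign an index. The vectors
  of length n and the n-by-n matrices, whose size is the degree bound and hence a term, are the
  \<open>real vec\<close> and \<open>real mat\<close> of Jordan_Normal_Form.
\<close>

no_notation Matrix.vec_index (infixl \<open>$\<close> 100)
no_notation Matrix.scalar_prod (infix \<open>\<bullet>\<close> 70)


definition poly_space :: "nat \<Rightarrow> real poly set" where
  "poly_space n = {p. degree p < n}"

definition sup_norm :: "real poly \<Rightarrow> real" where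
  "sup_norm p = (SUP x\<in>{-1..1}. \<bar>poly p x\<bar>)"

definition model_set :: "nat \<Rightarrow> real poly set" where
  "model_set n = {f \<in> poly_space n. sup_norm f \<le> 1}"

definition uncertainty_set :: "real \<Rightarrow> (real ^ 'm) set" where
  "uncertainty_set \<eta> = {e. infnorm e \<le> \<eta>}"

text \<open>Nothing is required of the values outside \<open>poly_space n\<close>.\<close>

definition linear_functional_on_polys :: "nat \<Rightarrow> (real poly \<Rightarrow> real) \<Rightarrow> bool" where
  "linear_functional_on_polys n \<phi> \<longleftrightarrow>
     (\<forall>p\<in>poly_space n. \<forall>q\<in>poly_space n. \<phi> (p + q) = \<phi> p + \<phi> q) \<and>
     (\<forall>c. \<forall>p\<in>poly_space n. \<phi> (Polynomial.smult c p) = c * \<phi> p)"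

fun cheb_T :: "nat \<Rightarrow> real poly" where
  "cheb_T 0 = 1"
| "cheb_T (Suc 0) = [:0, 1:]"
| "cheb_T (Suc (Suc j)) = [:0, 2:] * cheb_T (Suc j) - cheb_T j"


text \<open>
  Local optimality, for a norm \<open>nrm\<close> on the target space. The worst-case errors are taken in the
  extended reals, so that no boundedness is presupposed.
\<close>

definition worst_case_error ::
    "('z::ab_group_add \<Rightarrow> real) \<Rightarrow> 'x set \<Rightarrow> 'y::ab_group_add set \<Rightarrow> ('x \<Rightarrow> 'y) \<Rightarrow> ('x \<Rightarrow> 'z)
     \<Rightarrow> 'y \<Rightarrow> 'z \<Rightarrow> ereal" where
  "worst_case_error nrm \<K> \<E> L Q y w =
     (SUP (f, e) \<in> {(f, e). f \<in> \<K> \<and> e \<in> \<E> \<and> L f + e = y}. ereal (nrm (Q f - w)))"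

definition locally_optimal_at ::
    "('z::ab_group_add \<Rightarrow> real) \<Rightarrow> 'x set \<Rightarrow> 'y::ab_group_add set \<Rightarrow> ('x \<Rightarrow> 'y) \<Rightarrow> ('x \<Rightarrow> 'z)
     \<Rightarrow> ('y \<Rightarrow> 'z) \<Rightarrow> 'y \<Rightarrow> bool" where
  "locally_optimal_at nrm \<K> \<E> L Q R y \<longleftrightarrow>
     worst_case_error nrm \<K> \<E> L Q y (R y) = (INF w. worst_case_error nrm \<K> \<E> L Q y w)"


text \<open>Indices start at 0 here, so \<open>vec_index x 0\<close> is the component written \<open>x\<^sub>1\<close> on paper.\<close>

definition toep :: "real vec \<Rightarrow> real mat" where
  "toep x = mat (dim_vec x) (dim_vec x) (\<lambda>(i, j). vec_index x (nat \<bar>int i - int j\<bar>))"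

definition psd_mat :: "real mat \<Rightarrow> bool" where
  "psd_mat A \<longleftrightarrow> square_mat A \<and> transpose_mat A = A \<and>
     (\<forall>w \<in> carrier_vec (dim_row A). scalar_prod w (A *\<^sub>v w) \<ge> 0)"

definition mat_lincomb :: "nat \<Rightarrow> real ^ 'm \<Rightarrow> ('m \<Rightarrow> real mat) \<Rightarrow> real mat" where
  "mat_lincomb n c A = mat n n (\<lambda>(a, b). \<Sum>i\<in>UNIV. c $ i * (A i $$ (a, b)))"


datatype sign = Pos | Neg

fun sign_val :: "sign \<Rightarrow> real" where
  "sign_val Pos = 1"
| "sign_val Neg = -1"

definition sdp_matrix ::
    "nat \<Rightarrow> ('m \<Rightarrow> real mat) \<Rightarrow> ('k \<Rightarrow> real mat) \<Rightarrow> sign \<Rightarrow> 'k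
     \<Rightarrow> real ^ 'm \<Rightarrow> real ^ 'm \<Rightarrow> real mat" where
  "sdp_matrix n A C s k u v = sign_val s \<cdot>\<^sub>m C k + mat_lincomb n (v - u) A"

definition sdp_feasible ::
    "nat \<Rightarrow> real \<Rightarrow> ('m \<Rightarrow> real mat) \<Rightarrow> ('k \<Rightarrow> real mat) \<Rightarrow> real ^ 'm
     \<Rightarrow> real ^ 'k \<Rightarrow> real \<Rightarrow> (sign \<Rightarrow> 'k \<Rightarrow> real vec)
     \<Rightarrow> (sign \<Rightarrow> 'k \<Rightarrow> real ^ 'm) \<Rightarrow> (sign \<Rightarrow> 'k \<Rightarrow> real ^ 'm) \<Rightarrow> bool" where
  "sdp_feasible n \<eta> A C y z r x u v \<longleftrightarrow>
     (\<forall>s k.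
        x s k \<in> carrier_vec n \<and>
        vec_index (x s k) 0 + inner (u s k) (\<chi> i. y $ i + \<eta>) - inner (v s k) (\<chi> i. y $ i - \<eta>)
          \<le> r + sign_val s * z $ k \<and>
        u s k \<ge> 0 \<and> v s k \<ge> 0 \<and>
        psd_mat (toep (x s k) - sdp_matrix n A C s k (u s k) (v s k)) \<and>
        psd_mat (toep (x s k) - (- sdp_matrix n A C s k (u s k) (v s k))))"

text \<open>
  \<open>z\<close> is the z-component of a minimizer. For some data on the boundary of the set of possible
  observations the infimum is not attained, and then no \<open>z\<close> qualifies. For example, take n = 3,
  \<open>\<eta> = 0\<close>, one observation f(0) = 1 and the single quantity of interest f'(0).
\<close>

definition sdp_solution ::
    "nat \<Rightarrow> real \<Rightarrow> ('m \<Rightarrow> real mat) \<Rightarrow> ('k \<Rightarrow> real mat) \<Rightarrow> real ^ 'm \<Rightarrow> real ^ 'k \<Rightarrow> bool" where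
  "sdp_solution n \<eta> A C y z \<longleftrightarrow>
     (\<exists>r x u v. sdp_feasible n \<eta> A C y z r x u v \<and>
        (\<forall>z' r' x' u' v'. sdp_feasible n \<eta> A C y z' r' x' u' v' \<longrightarrow> r \<le> r'))"

end

theory Submission
  imports Defs "HOL-Computational_Algebra.Fundamental_Theorem_Algebra"
begin

text \<open>
  A symmetric Toeplitz matrix built from the values \<open>\<phi>(T\<^sub>j)\<close> of a linear form is positive semidefinite
  iff \<open>\<phi>\<close> is nonnegative on the polynomials that are nonnegative on \<open>[-1,1]\<close>: the quadratic form at
  \<open>w\<close> is \<open>\<phi>\<close> applied to the polynomial \<open>|\<Sum> w\<^sub>j exp(ijt)|\<^sup>2\<close> in \<open>cos t\<close>, and by Fejer-Riesz every
  positive polynomial is a sum of two of these. So the two semidefinite constraints say that the form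
  \<open>\<mu>\<close> with
  \<open>\<mu>(T\<^sub>j) = x\<^sub>j\<close> satisfies \<open>|\<psi>| \<le> \<mu>\<close> on nonnegative polynomials, where \<open>\<psi> = \<plusminus> Q\<^sub>k + \<Sum> (v\<^sub>i - u\<^sub>i) l\<^sub>i\<close>.
  Evaluating at \<open>1 \<plusminus> f\<close> gives \<open>\<psi> \<le> \<mu>(1)\<close> on the unit ball, and by M. Riesz extension
  every \<open>\<psi>\<close> of norm at most \<open>N\<close> admits such a \<open>\<mu>\<close> with \<open>\<mu>(1) = N\<close>. Lagrangian duality, through
  separation in the finite-dimensional data space, then shows that the infimum of \<open>r\<close> for fixed \<open>z\<close> is
  the worst-case error of \<open>z\<close>. Since minimizers in the dual need not exist, this holds up to an
  arbitrarily small \<open>\<epsilon>\<close>, which suffices.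
\<close>

subsection \<open>Linear forms and Chebyshev polynomials\<close>

lemma poly_cheb_T_cos: "poly (cheb_T j) (cos t) = cos (real j * t)"
proof (induction j rule: cheb_T.induct)
  case (3 j)
  have "cos (real (Suc (Suc j)) * t) + cos (real j * t) = 2 * cos t * cos (real (Suc j) * t)"
    using cos_add[of "real (Suc j) * t" t] cos_diff[of "real (Suc j) * t" t]
    by (simp add: algebra_simps)
  then show ?case
    using 3 by simp
qed simp_all

lemma degree_cheb_T: "degree (cheb_T j) = j"
proof (induction j rule: cheb_T.induct)
  case (3 j)
  have "cheb_T (Suc j) \<noteq> 0"
    using 3(1) by auto
  then have "degree ([:0, 2:] * cheb_T (Suc j)) = Suc (Suc j)"
    using 3(1) by (subst degree_mult_eq) auto
  then show ?case
    using 3(2) degree_add_eq_left[of "- cheb_T j" "[:0, 2:] * cheb_T (Suc j)"] by simp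
qed simp_all

lemma eq_poly_if_eq_on_interval:
  fixes p q :: "real poly"
  assumes "\<forall>x\<in>{-1..1}. poly p x = poly q x"
  shows "p = q"
proof (rule ccontr)
  assume "p \<noteq> q"
  then have "finite {x. poly (p - q) x = 0}"
    by (intro poly_roots_finite) simp
  moreover have "{-1..1} \<subseteq> {x. poly (p - q) x = 0}"
    using assms by auto
  ultimately have "finite {-1..1::real}"
    by (rule rev_finite_subset)
  then show False
    using infinite_Icc[of "-1::real" 1] by simp
qed

text \<open>Linearity on all of \<open>real poly\<close> frees the calculations from degree side
  conditions. The given functionals, controlled only on \<open>poly_space n\<close>, get replaced by
  such forms agreeing with them there.\<close>

definition linear_form :: "(real poly \<Rightarrow> real) \<Rightarrow> bool" where
  "linear_form \<phi> \<longleftrightarrow>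
     (\<forall>p q. \<phi> (p + q) = \<phi> p + \<phi> q) \<and> (\<forall>c p. \<phi> (Polynomial.smult c p) = c * \<phi> p)"

lemma linear_form_add: "linear_form \<phi> \<Longrightarrow> \<phi> (p + q) = \<phi> p + \<phi> q"
  and linear_form_smult: "linear_form \<phi> \<Longrightarrow> \<phi> (Polynomial.smult c p) = c * \<phi> p"
  by (auto simp: linear_form_def)

lemma linear_form_minus: "linear_form \<phi> \<Longrightarrow> \<phi> (- p) = - \<phi> p"
  using linear_form_smult[of \<phi> "-1" p] by simp

lemma linear_form_diff: "linear_form \<phi> \<Longrightarrow> \<phi> (p - q) = \<phi> p - \<phi> q"
  using linear_form_add[of \<phi> p "- q"] by (simp add: linear_form_minus)

lemma linear_form_0: "linear_form \<phi> \<Longrightarrow> \<phi> 0 = 0"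
  using linear_form_smult[of \<phi> 0 0] by simp

lemma linear_form_sum: "linear_form \<phi> \<Longrightarrow> \<phi> (\<Sum>j\<in>J. p j) = (\<Sum>j\<in>J. \<phi> (p j))"
  by (induction J rule: infinite_finite_induct) (auto simp: linear_form_0 linear_form_add)

lemmas linear_form_simps =
  linear_form_add linear_form_smult linear_form_minus linear_form_diff linear_form_0 linear_form_sum

lemma linear_form_combination:
  "linear_form \<phi> \<Longrightarrow> (\<And>i. i \<in> I \<Longrightarrow> linear_form (\<psi> i)) \<Longrightarrow>
    linear_form (\<lambda>p. a * \<phi> p + (\<Sum>i\<in>I. c i * \<psi> i p))"
  by (auto simp: linear_form_def sum.distrib sum_distrib_left algebra_simps)

text \<open>Truncation to the coefficients below \<open>n\<close> is a linear projection onto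
  \<open>poly_space n\<close>; precomposing with it gives the extension.\<close>

lemma linear_functional_extends:
  assumes "linear_functional_on_polys n \<phi>" "n \<ge> 1"
  shows "\<exists>\<phi>'. linear_form \<phi>' \<and> (\<forall>p\<in>poly_space n. \<phi>' p = \<phi> p)"
proof (intro exI conjI ballI)
  have deg: "poly_cutoff n p \<in> poly_space n" for p :: "real poly"
    unfolding poly_space_def using assms(2)
    by (auto simp: coeff_poly_cutoff intro!: degree_lessI)
  have "poly_cutoff n (p + q) = poly_cutoff n p + poly_cutoff n q"
    and "poly_cutoff n (Polynomial.smult c p) = Polynomial.smult c (poly_cutoff n p)"
    for p q :: "real poly" and c
    by (rule poly_eqI, simp add: coeff_poly_cutoff)+
  with deg show "linear_form (\<phi> \<circ> poly_cutoff n)"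
    using assms(1) by (simp add: linear_form_def linear_functional_on_polys_def)
  show "(\<phi> \<circ> poly_cutoff n) p = \<phi> p" if "p \<in> poly_space n" for p
  proof -
    have "poly_cutoff n p = p"
      using that by (intro poly_eqI) (auto simp: coeff_poly_cutoff poly_space_def coeff_eq_0)
    then show ?thesis by simp
  qed
qed

text \<open>Lets an arbitrary vector be read as a linear form. In the induction the coefficient
  functional of degree \<open>n\<close>, which vanishes on the earlier Chebyshev polynomials but not
  on \<open>cheb_T n\<close>, corrects the last value.\<close>

lemma ex_linear_form_cheb_T: "\<exists>\<mu>. linear_form \<mu> \<and> (\<forall>j<n. \<mu> (cheb_T j) = x j)"
proof (induction n)
  case 0
  have "linear_form (\<lambda>_. 0)" by (simp add: linear_form_def)
  then show ?case by auto
next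
  case (Suc n)
  then obtain \<mu> where \<mu>: "linear_form \<mu>" "\<forall>j<n. \<mu> (cheb_T j) = x j"
    by blast
  define c where "c = coeff (cheb_T n) n"
  define \<mu>' where "\<mu>' p = \<mu> p + (x n - \<mu> (cheb_T n)) * (coeff p n / c)" for p
  have "cheb_T n \<noteq> 0"
    using degree_cheb_T[of n] by (cases n) auto
  then have "c \<noteq> 0"
    using leading_coeff_neq_0[of "cheb_T n"] by (simp add: c_def degree_cheb_T)
  moreover have "linear_form \<mu>'"
    using \<mu>(1) by (simp add: linear_form_def \<mu>'_def add_divide_distrib ring_distribs)
  moreover have "\<mu>' (cheb_T j) = \<mu> (cheb_T j)" if "j < n" for j
    using that by (simp add: \<mu>'_def coeff_eq_0 degree_cheb_T)
  moreover have "\<mu>' (cheb_T n) = x n"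
    using \<open>c \<noteq> 0\<close> by (simp add: \<mu>'_def c_def)
  ultimately show ?case
    using \<mu>(2) by (metis less_SucE)
qed

subsection \<open>Fejer-Riesz factorization\<close>

lemma map_poly_of_real_add:
  "map_poly of_real (p + q) = map_poly of_real p + (map_poly of_real q :: complex poly)"
  by (rule poly_eqI) (simp add: coeff_map_poly)

lemma poly_map_poly_of_real_mult:
  "poly (map_poly of_real (p * q)) z
    = poly (map_poly of_real p) z * (poly (map_poly of_real q) z :: complex)"
proof (induction p)
  case (pCons a p)
  then show ?case
    by (simp add: map_poly_of_real_add map_poly_pCons map_poly_smult algebra_simps)
qed simp

lemma poly_map_poly_of_real:
  "poly (map_poly of_real p) (of_real x :: complex) = of_real (poly p x)"
  by (induction p) (simp_all add: map_poly_pCons)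

text \<open>The remainder modulo this quadratic is a + b X with real a and b, and it also vanishes
  at \<open>z\<close>. The imaginary part forces b = 0, then the real part a = 0.\<close>

lemma quadratic_dvd_if_nonreal_root:
  fixes f :: "real poly" and z :: complex
  assumes "poly (map_poly of_real f) z = 0" "Im z \<noteq> 0"
  shows "[:(Re z)\<^sup>2 + (Im z)\<^sup>2, - 2 * Re z, 1:] dvd f"
proof -
  define d where "d = [:(Re z)\<^sup>2 + (Im z)\<^sup>2, - 2 * Re z, 1:]"
  define r where "r = f mod d"
  have d0: "poly (map_poly of_real d) z = 0"
    by (simp add: d_def map_poly_pCons complex_eq_iff power2_eq_square algebra_simps)
  have "f = (f div d) * d + r"
    by (simp add: r_def)
  then have "poly (map_poly of_real f) z
      = poly (map_poly of_real (f div d)) z * poly (map_poly of_real d) z + poly (map_poly of_real r) z"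
    by (metis map_poly_of_real_add poly_add poly_map_poly_of_real_mult)
  then have r0: "poly (map_poly of_real r) z = 0"
    using assms(1) d0 by simp
  have "degree r \<le> 1"
    using degree_mod_less[of d f] by (auto simp: r_def d_def)
  then have "r = [:coeff r 0, coeff r 1:]"
    by (intro poly_eqI) (auto simp: coeff_pCons coeff_eq_0 split: nat.split)
  then obtain a b where r: "r = [:a, b:]"
    by blast
  have "of_real a + of_real b * z = 0"
    using r0 by (simp add: r map_poly_pCons mult.commute)
  then have "b * Im z = 0" "a + b * Re z = 0"
    by (simp_all add: complex_eq_iff)
  then have "r = 0"
    using assms(2) r by simp
  then show ?thesis
    by (simp add: r_def d_def mod_eq_0_iff_dvd)
qed

text \<open>For real s, the squared modulus of cis t - s is 1 + s^2 - 2 s cos t, which is affine in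
  cos t; it remains to choose s so that the zero falls at \<open>c\<close>, and to rescale.\<close>

lemma cos_diff_eq_trig_square:
  assumes "\<bar>c\<bar> > 1"
  shows "\<exists>h::complex poly. degree h = 1 \<and> (\<forall>t. \<bar>cos t - c\<bar> = (cmod (poly h (cis t)))\<^sup>2)"
proof -
  define d where "d = \<bar>c\<bar>"
  \<comment> \<open>The larger root of
    \<open>\<alpha>\<^sup>2 - 2 * d * \<alpha> + 1\<close>.\<close>
  define \<alpha> where "\<alpha> = d + sqrt (d\<^sup>2 - 1)"
  define h :: "complex poly"
    where "h = Polynomial.smult (of_real (1 / sqrt (2 * \<alpha>))) [:- of_real (sgn c * \<alpha>), 1:]"
  have d: "d > 1" and s: "sgn c * sgn c = 1"
    using assms by (auto simp: d_def sgn_if)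
  have d1: "d\<^sup>2 - 1 \<ge> 0"
    using d by (simp add: one_le_power)
  have \<alpha>: "\<alpha> > 0"
    using d d1 by (simp add: \<alpha>_def add_pos_nonneg)
  have "(\<alpha> - d)\<^sup>2 = d\<^sup>2 - 1"
    using d1 by (simp add: \<alpha>_def)
  then have \<alpha>2: "1 + \<alpha>\<^sup>2 = 2 * \<alpha> * d"
    by (simp add: power2_eq_square algebra_simps)
  have "\<bar>cos t - c\<bar> = (cmod (poly h (cis t)))\<^sup>2" for t
  proof -
    have "poly h (cis t) = of_real (1 / sqrt (2 * \<alpha>)) * (cis t - of_real (sgn c * \<alpha>))"
      by (simp add: h_def diff_divide_distrib)
    then have "(cmod (poly h (cis t)))\<^sup>2
        = (1 / (2 * \<alpha>)) * (cmod (cis t - of_real (sgn c * \<alpha>)))\<^sup>2"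
      using \<alpha> by (simp add: norm_mult power_mult_distrib norm_divide power_divide)
    also have "(cmod (cis t - of_real (sgn c * \<alpha>)))\<^sup>2
        = (cos t)\<^sup>2 + (sin t)\<^sup>2 + (sgn c * sgn c) * \<alpha>\<^sup>2 - 2 * sgn c * \<alpha> * cos t"
      unfolding cmod_power2 by (simp add: power2_eq_square algebra_simps)
    also have "\<dots> = 2 * \<alpha> * (d - sgn c * cos t)"
      unfolding s using \<alpha>2 by (simp add: algebra_simps)
    also have "1 / (2 * \<alpha>) * \<dots> = d - sgn c * cos t"
      using \<alpha> by simp
    also have "\<dots> = \<bar>cos t - c\<bar>"
    proof (cases "c > 0")
      case True
      then show ?thesis
        using cos_le_one[of t] assms by (simp add: d_def del: cos_le_one)
    next
      case False
      then show ?thesis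
        using cos_ge_minus_one[of t] assms by (simp add: d_def sgn_if del: cos_ge_minus_one)
    qed
    finally show ?thesis by simp
  qed
  moreover have "degree h = 1"
    using \<alpha> by (simp add: h_def)
  ultimately show ?thesis by blast
qed

text \<open>Induction on the degree, splitting off the real factor of one complex root: linear for a
  real root, which lies outside [-1,1], and quadratic for a conjugate pair. The absolute values
  spare tracking the signs of the factors.\<close>

lemma poly_eq_trig_square:
  fixes f :: "real poly"
  assumes "\<forall>x\<in>{-1..1}. poly f x \<noteq> 0"
  shows "\<exists>h::complex poly. degree h \<le> degree f \<and>
    (\<forall>t. \<bar>poly f (cos t)\<bar> = (cmod (poly h (cis t)))\<^sup>2)"
  using assms
proof (induction "degree f" arbitrary: f rule: less_induct)
  case less
  have step: ?case
    if f: "f = d * g" and deg: "degree h\<^sub>0 = degree d" "0 < degree d"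
      and h0: "\<forall>t. \<bar>poly d (cos t)\<bar> = (cmod (poly h\<^sub>0 (cis t)))\<^sup>2"
    for d g :: "real poly" and h\<^sub>0 :: "complex poly"
  proof -
    have "f \<noteq> 0"
      using less.prems[rule_format, of 0] by auto
    then have "degree f = degree d + degree g"
      using f by (auto simp: degree_mult_eq)
    moreover have "\<forall>x\<in>{-1..1}. poly g x \<noteq> 0"
      using less.prems f by auto
    ultimately obtain h :: "complex poly" where h: "degree h \<le> degree g"
        "\<forall>t. \<bar>poly g (cos t)\<bar> = (cmod (poly h (cis t)))\<^sup>2"
      using less.hyps[of g] deg by auto
    have "degree (h\<^sub>0 * h) \<le> degree f"
      using degree_mult_le[of h\<^sub>0 h] deg h(1) \<open>degree f = _\<close> by simp
    then show ?thesis
      using h(2) h0 by (intro exI[of _ "h\<^sub>0 * h"]) (simp add: f abs_mult norm_mult power_mult_distrib)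
  qed
  show ?case
  proof (cases "degree f = 0")
    case True
    then obtain a where "f = [:a:]"
      by (metis degree_eq_zeroE)
    then show ?thesis
      by (intro exI[of _ "[:of_real (sqrt \<bar>a\<bar>):]"]) simp
  next
    case False
    then have "\<not> constant (poly (map_poly of_real f :: complex poly))"
      by (simp add: constant_degree degree_map_poly)
    then obtain z :: complex where z: "poly (map_poly of_real f) z = 0"
      using fundamental_theorem_of_algebra by blast
    show ?thesis
    proof (cases "Im z = 0")
      case True
      then have "z = of_real (Re z)"
        by (simp add: complex_eq_iff)
      then have root: "poly f (Re z) = 0"
        using z poly_map_poly_of_real[of f "Re z"] of_real_eq_0_iff[of "poly f (Re z)"] by metis
      then have "Re z \<notin> {-1..1}"
        using less.prems by blast
      then have "\<bar>Re z\<bar> > 1"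
        by auto
      from cos_diff_eq_trig_square[OF this] obtain h\<^sub>0 :: "complex poly" where
        "degree h\<^sub>0 = 1" "\<forall>t. \<bar>cos t - Re z\<bar> = (cmod (poly h\<^sub>0 (cis t)))\<^sup>2"
        by blast
      then have "degree h\<^sub>0 = degree [:- Re z, 1:]" "0 < degree [:- Re z, 1:]"
        "\<forall>t. \<bar>poly [:- Re z, 1:] (cos t)\<bar> = (cmod (poly h\<^sub>0 (cis t)))\<^sup>2"
        by simp_all
      moreover obtain g where "f = [:- Re z, 1:] * g"
        using root unfolding poly_eq_0_iff_dvd by (elim dvdE)
      ultimately show ?thesis
        by (intro step)
    next
      case False
      \<comment> \<open>Chosen so that its value at \<open>cis t\<close> is
        \<open>cis t * (cos t - z)\<close>, whose squared modulus is
        \<open>poly d (cos t)\<close>.\<close>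
      define h\<^sub>0 :: "complex poly" where "h\<^sub>0 = [:1/2, - z, 1/2:]"
      define d where "d = [:(Re z)\<^sup>2 + (Im z)\<^sup>2, - 2 * Re z, 1:]"
      have "\<bar>poly d (cos t)\<bar> = (cmod (poly h\<^sub>0 (cis t)))\<^sup>2" for t
      proof -
        have "complex_of_real (cos t) = (cis t + cis (- t)) / 2"
          by (simp add: complex_eq_iff)
        then have "poly h\<^sub>0 (cis t) = cis t * (of_real (cos t) - z)"
          by (simp add: h\<^sub>0_def algebra_simps add_divide_distrib cis_mult)
        then have "(cmod (poly h\<^sub>0 (cis t)))\<^sup>2 = (cmod (of_real (cos t) - z))\<^sup>2"
          by (simp add: norm_mult)
        also have "\<dots> = (cos t - Re z)\<^sup>2 + (Im z)\<^sup>2"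
          by (simp add: cmod_power2)
        also have "\<dots> = poly d (cos t)"
          by (simp add: d_def power2_eq_square algebra_simps)
        finally show ?thesis
          by (metis abs_of_nonneg zero_le_power2)
      qed
      then have "\<forall>t. \<bar>poly d (cos t)\<bar> = (cmod (poly h\<^sub>0 (cis t)))\<^sup>2"
        by blast
      moreover have "degree h\<^sub>0 = degree d" "0 < degree d"
        by (simp_all add: h\<^sub>0_def d_def)
      moreover obtain g where "f = d * g"
        using quadratic_dvd_if_nonreal_root[OF z False] unfolding d_def by (elim dvdE)
      ultimately show ?thesis
        by (intro step)
    qed
  qed
qed

definition nonneg_on_interval :: "real poly \<Rightarrow> bool" where
  "nonneg_on_interval p \<longleftrightarrow> (\<forall>x\<in>{-1..1}. 0 \<le> poly p x)"

text \<open>At cos t this is the squared modulus of the trigonometric polynomial with real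
  coefficients \<open>w\<close>. Applying a linear form to it gives a Toeplitz quadratic form at
  \<open>w\<close>.\<close>

definition cheb_quad :: "nat \<Rightarrow> (nat \<Rightarrow> real) \<Rightarrow> real poly" where
  "cheb_quad n w = (\<Sum>i<n. \<Sum>j<n. Polynomial.smult (w i * w j) (cheb_T (nat \<bar>int i - int j\<bar>)))"

lemma cheb_quad_in_poly_space: "n \<ge> 1 \<Longrightarrow> cheb_quad n w \<in> poly_space n"
  unfolding cheb_quad_def poly_space_def
  by (auto intro!: degree_sum_less le_less_trans[OF degree_smult_le] simp: degree_cheb_T)

lemma poly_cheb_quad_cos:
  "poly (cheb_quad n w) (cos t) = (cmod (\<Sum>i<n. of_real (w i) * cis (real i * t)))\<^sup>2"
proof -
  let ?S = "\<Sum>i<n. of_real (w i) * cis (real i * t)"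
  have cos_abs: "cos (\<bar>real i - real j\<bar> * t) = cos (real i * t - real j * t)" for i j
    using cos_minus[of "real i * t - real j * t"] by (simp add: abs_if left_diff_distrib)
  have "complex_of_real ((cmod ?S)\<^sup>2) = ?S * cnj ?S"
    by (rule complex_norm_square)
  also have "\<dots> = (\<Sum>i<n. \<Sum>j<n. of_real (w i) * cis (real i * t) * cnj (of_real (w j) * cis (real j * t)))"
    by (simp add: sum_product cnj_sum)
  also have "Re \<dots> = (\<Sum>i<n. \<Sum>j<n. w i * w j * cos (real i * t - real j * t))"
    by (simp add: cos_diff algebra_simps)
  also have "\<dots> = poly (cheb_quad n w) (cos t)"
    by (simp add: cheb_quad_def poly_sum poly_cheb_T_cos cos_abs)
  finally show ?thesis by simp
qed

lemma nonneg_cheb_quad: "nonneg_on_interval (cheb_quad n w)"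
  unfolding nonneg_on_interval_def
proof
  fix x :: real assume "x \<in> {-1..1}"
  then have "x = cos (arccos x)" by simp
  then show "0 \<le> poly (cheb_quad n w) x"
    by (metis poly_cheb_quad_cos zero_le_power2)
qed

text \<open>The complex \<open>h\<close> with \<open>f(cos t) = |h(cis t)|\<^sup>2\<close> can be replaced by its real and imaginary coefficient
  sequences \<open>a\<close>, \<open>b\<close>: \<open>f(cos t)\<close> is even in \<open>t\<close>, and averaging over \<open>t\<close> and \<open>-t\<close> kills the mixed terms.\<close>

lemma fejer_riesz:
  assumes "f \<in> poly_space n" "\<forall>x\<in>{-1..1}. 0 < poly f x"
  shows "\<exists>a b. f = cheb_quad n a + cheb_quad n b"
proof -
  obtain h :: "complex poly" where h: "degree h \<le> degree f"
      "\<forall>t. \<bar>poly f (cos t)\<bar> = (cmod (poly h (cis t)))\<^sup>2"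
    using poly_eq_trig_square[of f] assms(2) by force
  define a b where "a i = Re (coeff h i)" and "b i = Im (coeff h i)" for i
  define S where "S w t = (\<Sum>i<n. of_real (w i) * cis (real i * t))" for w :: "nat \<Rightarrow> real" and t
  have polyh: "poly h (cis t) = S a t + \<i> * S b t" for t
  proof -
    have "poly h (cis t) = (\<Sum>i\<le>degree h. coeff h i * cis t ^ i)"
      by (rule poly_altdef)
    also have "\<dots> = (\<Sum>i<n. coeff h i * cis t ^ i)"
      using h(1) assms(1) by (intro sum.mono_neutral_left) (auto simp: coeff_eq_0 poly_space_def)
    also have "\<dots> = (\<Sum>i<n. of_real (a i) * cis (real i * t) + \<i> * (of_real (b i) * cis (real i * t)))"
    proof (rule sum.cong[OF refl])
      fix i
      have "coeff h i = of_real (a i) + \<i> * of_real (b i)"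
        by (simp add: a_def b_def complex_eq_iff)
      then show "coeff h i * cis t ^ i
          = of_real (a i) * cis (real i * t) + \<i> * (of_real (b i) * cis (real i * t))"
        by (simp only: Complex.DeMoivre distrib_right mult.assoc)
    qed
    finally show ?thesis
      by (simp add: S_def sum.distrib sum_distrib_left)
  qed
  \<comment> \<open>Since \<open>w\<close> is real, reflecting t conjugates the sum; this is what
    allows the values of |h|^2 at t and -t to be averaged.\<close>
  have S_minus: "S w (- t) = cnj (S w t)" for w t
    by (simp add: S_def cnj_sum cis_cnj)
  have "poly f x = poly (cheb_quad n a + cheb_quad n b) x" if x: "x \<in> {-1..1}" for x
  proof -
    define t where "t = arccos x"
    have t: "x = cos t"
      using x by (simp add: t_def)
    have "poly f x > 0"
      using assms(2) x by blast
    then have "poly f x = (cmod (S a t + \<i> * S b t))\<^sup>2"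
      using h(2)[rule_format, of t] by (simp add: polyh t)
    moreover have "poly f x = (cmod (cnj (S a t) + \<i> * cnj (S b t)))\<^sup>2"
      using \<open>poly f x > 0\<close> h(2)[rule_format, of "- t"] by (simp add: polyh[of "-t"] S_minus t)
    moreover have "(cmod (u + \<i> * v))\<^sup>2 + (cmod (cnj u + \<i> * cnj v))\<^sup>2
        = 2 * ((cmod u)\<^sup>2 + (cmod v)\<^sup>2)" for u v
      unfolding cmod_power2 by (simp add: power2_eq_square algebra_simps)
    ultimately have "poly f x = (cmod (S a t))\<^sup>2 + (cmod (S b t))\<^sup>2"
      by (smt (verit))
    then show ?thesis
      by (simp add: poly_cheb_quad_cos t S_def)
  qed
  then show ?thesis
    using eq_poly_if_eq_on_interval by blast
qed

section \<open>Positive semidefinite Toeplitz matrices and nonnegative forms\<close>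

lemma psd_toep_iff:
  "psd_mat (toep (vec n a)) \<longleftrightarrow>
    (\<forall>w. 0 \<le> (\<Sum>i<n. \<Sum>j<n. w i * w j * a (nat \<bar>int i - int j\<bar>)))" (is "_ \<longleftrightarrow> (\<forall>w. 0 \<le> ?q w)")
proof -
  let ?T = "toep (vec n a)"
  have T: "?T = mat n n (\<lambda>(i, j). a (nat \<bar>int i - int j\<bar>))"
    by (auto simp: toep_def intro!: eq_matI)
  have "transpose_mat ?T = ?T" "square_mat ?T" "dim_row ?T = n"
    by (auto simp: T abs_minus_commute intro!: eq_matI)
  moreover have "scalar_prod w (?T *\<^sub>v w) = ?q (vec_index w)" if "w \<in> carrier_vec n" for w
    using that
    by (auto simp: T scalar_prod_def sum_distrib_left atLeast0LessThan mult_ac intro!: sum.cong)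
  ultimately have "psd_mat ?T \<longleftrightarrow> (\<forall>w\<in>carrier_vec n. 0 \<le> ?q (vec_index w))"
    by (simp add: psd_mat_def)
  moreover have "0 \<le> ?q w" if "\<forall>w\<in>carrier_vec n. 0 \<le> ?q (vec_index w)" for w
    using bspec[OF that vec_carrier[of n w]] by simp
  ultimately show ?thesis
    by blast
qed

text \<open>Fejer-Riesz covers strictly positive polynomials; a merely nonnegative \<open>f\<close>
  is reached by adding a small constant.\<close>

lemma psd_toep_cheb_iff:
  assumes "linear_form \<phi>" "n \<ge> 1"
  shows "psd_mat (toep (vec n (\<lambda>j. \<phi> (cheb_T j)))) \<longleftrightarrow>
    (\<forall>f\<in>poly_space n. nonneg_on_interval f \<longrightarrow> 0 \<le> \<phi> f)"
proof -
  have quad: "\<phi> (cheb_quad n w) = (\<Sum>i<n. \<Sum>j<n. w i * w j * \<phi> (cheb_T (nat \<bar>int i - int j\<bar>)))" for w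
    using assms(1) by (simp add: cheb_quad_def linear_form_simps)
  have "0 \<le> \<phi> f"
    if pos: "\<And>w. 0 \<le> \<phi> (cheb_quad n w)" and f: "f \<in> poly_space n" "nonneg_on_interval f" for f
  proof (rule ccontr)
    assume neg: "\<not> 0 \<le> \<phi> f"
    \<comment> \<open>Small enough that \<open>\<epsilon> * \<phi> 1\<close> offsets at most half of
      the negative value \<open>\<phi> f\<close>.\<close>
    define \<epsilon> where "\<epsilon> = - \<phi> f / (2 * (\<bar>\<phi> 1\<bar> + 1))"
    have \<epsilon>: "\<epsilon> > 0"
      unfolding \<epsilon>_def using neg by (intro divide_pos_pos) auto
    have "f + Polynomial.smult \<epsilon> 1 \<in> poly_space n"
      using f(1) assms(2) by (auto simp: poly_space_def intro!: degree_add_less)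
    moreover have "\<forall>x\<in>{-1..1}. 0 < poly (f + Polynomial.smult \<epsilon> 1) x"
      using f(2) \<epsilon> by (auto simp: nonneg_on_interval_def intro!: add_nonneg_pos)
    ultimately obtain a b where "f + Polynomial.smult \<epsilon> 1 = cheb_quad n a + cheb_quad n b"
      using fejer_riesz by blast
    then have "0 \<le> \<phi> (f + Polynomial.smult \<epsilon> 1)"
      using pos assms(1) by (simp add: linear_form_add)
    then have "- \<phi> f \<le> \<epsilon> * \<phi> 1"
      using assms(1) by (simp add: linear_form_add linear_form_smult del: smult_one)
    also have "\<dots> \<le> \<epsilon> * (\<bar>\<phi> 1\<bar> + 1)"
      using \<epsilon> by (intro mult_left_mono) auto
    also have "\<dots> = - \<phi> f / 2"
      by (simp add: \<epsilon>_def field_simps add_eq_0_iff)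
    finally show False
      using neg by simp
  qed
  then show ?thesis
    using cheb_quad_in_poly_space[OF assms(2)] nonneg_cheb_quad
    unfolding psd_toep_iff quad[symmetric] by blast
qed

subsection \<open>Extension of bounded forms\<close>

lemma model_set_iff: "f \<in> model_set n \<longleftrightarrow> degree f < n \<and> (\<forall>x\<in>{-1..1}. \<bar>poly f x\<bar> \<le> 1)"
proof -
  \<comment> \<open>A real \<open>SUP\<close> is informative only over a bounded set; continuity on
    the compact interval supplies boundedness.\<close>
  have "compact ((\<lambda>x. \<bar>poly f x\<bar>) ` {-1..1})"
    by (intro compact_continuous_image continuous_intros) auto
  then have "bdd_above ((\<lambda>x. \<bar>poly f x\<bar>) ` {-1..1})"
    by (intro bounded_imp_bdd_above compact_imp_bounded)
  then have "sup_norm f \<le> 1 \<longleftrightarrow> (\<forall>x\<in>{-1..1}. \<bar>poly f x\<bar> \<le> 1)"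
    unfolding sup_norm_def by (subst cSUP_le_iff) auto
  then show ?thesis
    by (auto simp: model_set_def poly_space_def)
qed

lemma abs_linear_form_le:
  assumes "linear_form \<psi>" "\<forall>f\<in>model_set n. \<psi> f \<le> N"
    and "degree f < n" "\<forall>x\<in>{-1..1}. \<bar>poly f x\<bar> \<le> t"
  shows "\<psi> f \<le> t * N"
proof (cases "t > 0")
  case True
  have "Polynomial.smult (1 / t) f \<in> model_set n"
    using assms(3,4) True by (auto simp: model_set_iff field_simps abs_mult)
  then have "1 / t * \<psi> f \<le> N"
    using assms(1,2) by (metis linear_form_smult)
  then show ?thesis
    using True by (simp add: field_simps)
next
  case False
  \<comment> \<open>Scaling by 1/t is impossible here, but t can only be 0, and then
    \<open>f\<close> vanishes on the interval and is the zero polynomial.\<close>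
  have "0 \<le> t"
    using assms(4)[rule_format, of 0] by simp
  with False have "t = 0" by simp
  then have "f = 0"
    using assms(4) by (intro eq_poly_if_eq_on_interval) auto
  with \<open>t = 0\<close> show ?thesis
    using assms(1) by (simp add: linear_form_0)
qed

text \<open>M. Riesz extension, one degree at a time; a pair \<open>(p, s)\<close> in \<open>\<Gamma>\<close> demands \<open>\<mu> p \<ge> s\<close>.\<close>

lemma riesz_extension_poly:
  fixes \<Gamma> :: "(real poly \<times> real) set"
  assumes add: "\<And>p s p' s'. (p, s) \<in> \<Gamma> \<Longrightarrow> (p', s') \<in> \<Gamma> \<Longrightarrow> (p + p', s + s') \<in> \<Gamma>"
    and scale: "\<And>c p s. c > 0 \<Longrightarrow> (p, s) \<in> \<Gamma> \<Longrightarrow> (Polynomial.smult c p, c * s) \<in> \<Gamma>"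
    and base: "\<And>c s. ([:c:], s) \<in> \<Gamma> \<Longrightarrow> s \<le> c * N"
    and upper: "\<And>k. 1 \<le> k \<Longrightarrow> k < n \<Longrightarrow> \<exists>g s. degree g < k \<and> (g + Polynomial.monom 1 k, s) \<in> \<Gamma>"
    and lower: "\<And>k. 1 \<le> k \<Longrightarrow> k < n \<Longrightarrow> \<exists>g s. degree g < k \<and> (g - Polynomial.monom 1 k, s) \<in> \<Gamma>"
    and "n \<ge> 1"
  shows "\<exists>\<mu>. linear_form \<mu> \<and> \<mu> 1 = N \<and> (\<forall>p s. (p, s) \<in> \<Gamma> \<longrightarrow> degree p < n \<longrightarrow> s \<le> \<mu> p)"
proof -
  have "k \<le> n \<Longrightarrow>
      \<exists>\<mu>. linear_form \<mu> \<and> \<mu> 1 = N \<and> (\<forall>p s. (p, s) \<in> \<Gamma> \<longrightarrow> degree p < k \<longrightarrow> s \<le> \<mu> p)"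
    if "k \<ge> 1" for k
    using that
  proof (induction k rule: nat_induct_at_least)
    case base
    have "s \<le> coeff p 0 * N" if ps: "(p, s) \<in> \<Gamma>" "degree p < 1" for p s
    proof -
      obtain c where "p = [:c:]"
        using ps(2) by (auto elim: degree_eq_zeroE)
      then show ?thesis
        using assms(3) ps(1) by simp
    qed
    moreover have "linear_form (\<lambda>p. coeff p 0 * N)"
      by (simp add: linear_form_def algebra_simps)
    ultimately show ?case
      by (intro exI[of _ "\<lambda>p. coeff p 0 * N"]) simp
  next
    case (Suc k)
    define m :: "real poly" where "m = Polynomial.monom 1 k"
    from Suc obtain \<mu> where \<mu>: "linear_form \<mu>" "\<mu> 1 = N"
        "\<And>p s. (p, s) \<in> \<Gamma> \<Longrightarrow> degree p < k \<Longrightarrow> s \<le> \<mu> p"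
      by auto
    \<comment> \<open>The lower bounds that \<open>\<Gamma>\<close> imposes on the value at
      \<open>m\<close>, once \<open>\<mu>\<close> is fixed below degree k.\<close>
    define U where "U = {s - \<mu> g | g s. degree g < k \<and> (g + m, s) \<in> \<Gamma>}"
    \<comment> \<open>Adding two opposite demands cancels \<open>m\<close>, so every lower bound is
      below every upper bound.\<close>
    have le: "s - \<mu> g \<le> \<mu> g' - s'"
      if "degree g < k" "(g + m, s) \<in> \<Gamma>" "degree g' < k" "(g' - m, s') \<in> \<Gamma>" for g s g' s'
    proof -
      have "(g + g', s + s') \<in> \<Gamma>"
        using add[OF that(2,4)] by simp
      then have "s + s' \<le> \<mu> (g + g')"
        using that by (intro \<mu>(3)) (auto intro!: degree_add_less)
      then show ?thesis
        using \<mu>(1) by (simp add: linear_form_add)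
    qed
    \<comment> \<open>\<open>lower\<close> bounds \<open>U\<close> from above and
      \<open>upper\<close> gives it a member, so \<open>Sup U\<close> is a genuine supremum.\<close>
    obtain g\<^sub>0 s\<^sub>0 where gs0: "degree g\<^sub>0 < k" "(g\<^sub>0 - m, s\<^sub>0) \<in> \<Gamma>"
      using lower[of k] Suc by (auto simp: m_def)
    have "bdd_above U"
      using le gs0 by (auto simp: U_def intro!: bdd_aboveI[of _ "\<mu> g\<^sub>0 - s\<^sub>0"])
    moreover have "U \<noteq> {}"
      using upper[of k] Suc by (auto simp: U_def m_def)
    ultimately have \<xi>_ge: "s - \<mu> g \<le> Sup U" if "degree g < k" "(g + m, s) \<in> \<Gamma>" for g s
      using that by (intro cSup_upper) (auto simp: U_def)
    have \<xi>_le: "Sup U \<le> \<mu> g - s" if "degree g < k" "(g - m, s) \<in> \<Gamma>" for g s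
      using le that \<open>U \<noteq> {}\<close> by (intro cSup_least) (auto simp: U_def)
    \<comment> \<open>Agrees with \<open>\<mu>\<close> below degree k and takes the value
      \<open>Sup U\<close> at \<open>m\<close>.\<close>
    define \<mu>' where "\<mu>' p = \<mu> p + (Sup U - \<mu> m) * coeff p k" for p
    have "linear_form \<mu>'"
      using \<mu>(1) by (simp add: linear_form_def \<mu>'_def algebra_simps)
    moreover have "\<mu>' 1 = N"
      using \<mu>(2) Suc by (simp add: \<mu>'_def coeff_eq_0)
    moreover have "s \<le> \<mu>' p" if p: "(p, s) \<in> \<Gamma>" "degree p < Suc k" for p s
    proof -
      define c where "c = coeff p k"
      define g where "g = p - Polynomial.smult c m"
      have "coeff g i = 0" if "i \<ge> k" for i
        using that p(2) by (cases "i = k") (auto simp: g_def c_def m_def coeff_eq_0)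
      then have g: "degree g < k"
        using Suc by (intro degree_lessI) auto
      have \<mu>'p: "\<mu>' p = \<mu> g + c * Sup U"
        using \<mu>(1) by (simp add: \<mu>'_def g_def c_def linear_form_simps algebra_simps)
      \<comment> \<open>Dividing by |c| makes the leading coefficient 1 or -1, the two cases that
        \<open>Sup U\<close> was placed to satisfy.\<close>
      consider "c = 0" | "c > 0" | "c < 0" by linarith
      then show ?thesis
      proof cases
        case 1
        then show ?thesis
          using \<mu>(3)[of p s] p(1) g \<mu>'p by (simp add: g_def)
      next
        case 2
        have "(Polynomial.smult (1 / c) g + m, 1 / c * s) \<in> \<Gamma>"
          using scale[of "1 / c" p s] p(1) 2 by (simp add: g_def smult_diff_right)
        then have "1 / c * s - \<mu> (Polynomial.smult (1 / c) g) \<le> Sup U"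
          using g 2 by (intro \<xi>_ge) auto
        then show ?thesis
          using 2 \<mu>(1) \<mu>'p by (simp add: linear_form_smult field_simps)
      next
        case 3
        have "(Polynomial.smult (1 / - c) g - m, 1 / - c * s) \<in> \<Gamma>"
          using scale[of "1 / - c" p s] p(1) 3 by (simp add: g_def smult_diff_right)
        then have "Sup U \<le> \<mu> (Polynomial.smult (1 / - c) g) - 1 / - c * s"
          using g 3 by (intro \<xi>_le) auto
        then show ?thesis
          using 3 \<mu>(1) \<mu>'p by (simp add: linear_form_smult linear_form_minus field_simps)
      qed
    qed
    ultimately show ?case by blast
  qed
  then show ?thesis
    using \<open>n \<ge> 1\<close> by blast
qed

text \<open>\<open>\<mu>\<close> plays the part of the total variation of \<open>\<psi>\<close>. The
  demands \<open>\<mu> (a + b) \<ge> \<psi> a - \<psi> b\<close> for nonnegative a and b contain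
  both signs of domination, by taking b = 0 or a = 0 and swapping.\<close>

lemma ex_dominating_form:
  assumes \<psi>: "linear_form \<psi>" "\<forall>f\<in>model_set n. \<psi> f \<le> N" and "n \<ge> 1"
  shows "\<exists>\<mu>. linear_form \<mu> \<and> \<mu> 1 = N \<and>
    (\<forall>f\<in>poly_space n. nonneg_on_interval f \<longrightarrow> \<bar>\<psi> f\<bar> \<le> \<mu> f)"
proof -
  define P where "P = {p \<in> poly_space n. nonneg_on_interval p}"
  define \<Gamma> where "\<Gamma> = {(a + b, \<psi> a - \<psi> b) | a b. a \<in> P \<and> b \<in> P}"
  have P_add: "a + b \<in> P" if "a \<in> P" "b \<in> P" for a b
    using that by (auto simp: P_def poly_space_def nonneg_on_interval_def intro: degree_add_less)
  have P_scale: "Polynomial.smult c a \<in> P" if "a \<in> P" "c > 0" for a c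
    using that by (auto simp: P_def poly_space_def nonneg_on_interval_def)
  have P0: "0 \<in> P"
    using \<open>n \<ge> 1\<close> by (simp add: P_def poly_space_def nonneg_on_interval_def)
  \<comment> \<open>1 + x^k and 1 - x^k are nonnegative on the interval, so each new monomial is
    bounded on both sides, as the extension requires.\<close>
  have P_monom: "1 + Polynomial.monom c k \<in> P" if "\<bar>c\<bar> = 1" "k < n" for c k
  proof -
    have "0 \<le> 1 + c * x ^ k" if "x \<in> {-1..1}" for x :: real
    proof -
      have "\<bar>c * x ^ k\<bar> \<le> 1"
        using \<open>\<bar>c\<bar> = 1\<close> that by (simp add: abs_mult power_abs power_le_one abs_le_iff)
      then show ?thesis by simp
    qed
    moreover have "degree (1 + Polynomial.monom c k) < n"
      using that by (auto intro!: degree_add_less le_less_trans[OF degree_monom_le])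
    ultimately show ?thesis
      by (auto simp: P_def poly_space_def nonneg_on_interval_def poly_monom)
  qed
  have \<Gamma>I: "(a, \<psi> a) \<in> \<Gamma>" "(a, - \<psi> a) \<in> \<Gamma>" if "a \<in> P" for a
    using that P0 linear_form_0[OF \<psi>(1)] by (force simp: \<Gamma>_def)+
  have "\<exists>\<mu>. linear_form \<mu> \<and> \<mu> 1 = N \<and> (\<forall>p s. (p, s) \<in> \<Gamma> \<longrightarrow> degree p < n \<longrightarrow> s \<le> \<mu> p)"
  proof (rule riesz_extension_poly)
    show "(p + p', s + s') \<in> \<Gamma>" if "(p, s) \<in> \<Gamma>" "(p', s') \<in> \<Gamma>" for p s p' s'
    proof -
      from that obtain a b a' b' where "p = a + b" "s = \<psi> a - \<psi> b" "p' = a' + b'" "s' = \<psi> a' - \<psi> b'"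
        and "a \<in> P" "b \<in> P" "a' \<in> P" "b' \<in> P"
        by (auto simp: \<Gamma>_def)
      moreover from this have "p + p' = (a + a') + (b + b')" "s + s' = \<psi> (a + a') - \<psi> (b + b')"
        using \<psi>(1) by (simp_all add: linear_form_add)
      ultimately show ?thesis
        unfolding \<Gamma>_def using P_add by blast
    qed
    show "(Polynomial.smult c p, c * s) \<in> \<Gamma>" if "c > 0" "(p, s) \<in> \<Gamma>" for c p s
    proof -
      from that obtain a b where "p = a + b" "s = \<psi> a - \<psi> b" "a \<in> P" "b \<in> P"
        by (auto simp: \<Gamma>_def)
      moreover from this have "Polynomial.smult c p = Polynomial.smult c a + Polynomial.smult c b"
        "c * s = \<psi> (Polynomial.smult c a) - \<psi> (Polynomial.smult c b)"
        using \<psi>(1) by (simp_all add: linear_form_smult smult_add_right right_diff_distrib)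
      ultimately show ?thesis
        unfolding \<Gamma>_def using P_scale \<open>c > 0\<close> by blast
    qed
    show "s \<le> c * N" if "([:c:], s) \<in> \<Gamma>" for c s
    proof -
      from that obtain a b where ab: "[:c:] = a + b" "s = \<psi> a - \<psi> b" "a \<in> P" "b \<in> P"
        by (auto simp: \<Gamma>_def)
      \<comment> \<open>For nonnegative a and b, |a - b| is at most a + b, here the constant c, so
        the bound of \<open>\<psi>\<close> on the unit ball applies.\<close>
      have "\<bar>poly (a - b) x\<bar> \<le> c" if "x \<in> {-1..1}" for x
      proof -
        have "0 \<le> poly a x" "0 \<le> poly b x"
          using ab(3,4) that by (auto simp: P_def nonneg_on_interval_def)
        moreover have "c = poly a x + poly b x"
          using arg_cong[OF ab(1), of "\<lambda>p. poly p x"] by simp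
        ultimately show ?thesis by simp
      qed
      moreover have "degree (a - b) < n"
        using ab(3,4) by (auto simp: P_def poly_space_def intro: degree_diff_less)
      ultimately have "\<psi> (a - b) \<le> c * N"
        using \<psi> by (intro abs_linear_form_le[of \<psi> n N]) auto
      then show ?thesis
        using ab(2) \<psi>(1) by (simp add: linear_form_diff)
    qed
    fix k assume k: "1 \<le> k" "k < n"
    show "\<exists>g s. degree g < k \<and> (g + Polynomial.monom 1 k, s) \<in> \<Gamma>"
      using \<Gamma>I(1)[OF P_monom[of 1 k]] k
      by (intro exI[of _ 1] exI[of _ "\<psi> (1 + Polynomial.monom 1 k)"]) auto
    show "\<exists>g s. degree g < k \<and> (g - Polynomial.monom 1 k, s) \<in> \<Gamma>"
      using \<Gamma>I(1)[OF P_monom[of "-1" k]] k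
      by (intro exI[of _ 1] exI[of _ "\<psi> (1 + Polynomial.monom (-1) k)"]) (auto simp flip: minus_monom)
  qed fact
  then obtain \<mu> where \<mu>: "linear_form \<mu>" "\<mu> 1 = N" "\<And>p s. (p, s) \<in> \<Gamma> \<Longrightarrow> degree p < n \<Longrightarrow> s \<le> \<mu> p"
    by blast
  have "\<bar>\<psi> f\<bar> \<le> \<mu> f" if "f \<in> P" for f
    using \<mu>(3)[OF \<Gamma>I(1)[OF that]] \<mu>(3)[OF \<Gamma>I(2)[OF that]] that
    by (auto simp: P_def poly_space_def)
  then show ?thesis
    using \<mu>(1,2) by (auto simp: P_def)
qed

subsection \<open>Duality\<close>

text \<open>Used to take nodal values as coordinates on polynomials of bounded degree.\<close>

lemma ex_lagrange_basis:
  fixes t :: "nat \<Rightarrow> 'a::field"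
  assumes "inj_on t {..<n}"
  shows "\<exists>b. (\<forall>j<n. degree (b j) < n) \<and>
    (\<forall>f. degree f < n \<longrightarrow> f = (\<Sum>j<n. Polynomial.smult (poly f (t j)) (b j)))"
proof -
  define d where "d j = (\<Prod>i\<in>{..<n} - {j}. [:- t i, 1:])" for j
  define b where "b j = Polynomial.smult (1 / poly (d j) (t j)) (d j)" for j
  have degree_b: "degree (b j) < n" if "j < n" for j
  proof -
    have "degree (d j) \<le> sum (degree \<circ> (\<lambda>i. [:- t i, 1:])) ({..<n} - {j})"
      unfolding d_def by (rule degree_prod_sum_le) simp
    then have "degree (d j) \<le> n - 1"
      using that by simp
    then show ?thesis
      using that le_less_trans[OF degree_smult_le] by (auto simp: b_def)
  qed
  have poly_b: "poly (b j) (t k) = (if j = k then 1 else 0)" if "j < n" "k < n" for j k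
  proof (cases "j = k")
    case True
    have "poly (d j) (t j) \<noteq> 0"
      using that assms by (auto simp: d_def poly_prod inj_on_eq_iff)
    then show ?thesis
      using True by (simp add: b_def)
  next
    case False
    then have "poly (d j) (t k) = 0"
      using that by (auto simp: d_def poly_prod)
    then show ?thesis
      using False by (simp add: b_def)
  qed
  have "f = (\<Sum>j<n. Polynomial.smult (poly f (t j)) (b j))" if f: "degree f < n" for f
  proof (rule poly_eqI_degree[where A = "t ` {..<n}"])
    have "card (t ` {..<n}) = n"
      using assms by (simp add: card_image)
    moreover have "degree (\<Sum>j<n. Polynomial.smult (poly f (t j)) (b j)) < n"
      using f degree_b by (auto intro!: degree_sum_less le_less_trans[OF degree_smult_le])
    ultimately show "degree f < card (t ` {..<n})"
      "degree (\<Sum>j<n. Polynomial.smult (poly f (t j)) (b j)) < card (t ` {..<n})"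
      using f by simp_all
  next
    fix x assume "x \<in> t ` {..<n}"
    then obtain k where "k < n" "x = t k"
      by auto
    then have "poly (\<Sum>j<n. Polynomial.smult (poly f (t j)) (b j)) x
        = (\<Sum>j<n. if j = k then poly f (t j) else 0)"
      unfolding poly_sum by (intro sum.cong) (simp_all add: poly_b)
    then show "poly f x = poly (\<Sum>j<n. Polynomial.smult (poly f (t j)) (b j)) x"
      using \<open>k < n\<close> \<open>x = t k\<close> by simp
  qed
  then show ?thesis
    using degree_b by blast
qed

text \<open>Compactness is obtained without a topology on polynomials: nodal values place the unit
  ball in a cube of sequences, compact by Tychonoff, and \<open>\<Phi>\<close> is continuous in
  these coordinates.\<close>

lemma compact_image_model_set:
  fixes \<Phi> :: "real poly \<Rightarrow> 'a::real_normed_vector"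
  assumes add: "\<And>p q. \<Phi> (p + q) = \<Phi> p + \<Phi> q"
    and scale: "\<And>c p. \<Phi> (Polynomial.smult c p) = c *\<^sub>R \<Phi> p"
    and "n \<ge> 1"
  shows "compact (\<Phi> ` model_set n)"
proof -
  have sum: "\<Phi> (\<Sum>j\<in>J. p j) = (\<Sum>j\<in>J. \<Phi> (p j))" for p and J :: "nat set"
    using scale[of 0 0] by (induction J rule: infinite_finite_induct) (auto simp: add)
  define t :: "nat \<Rightarrow> real" where "t j = 1 / (real j + 1)" for j
  have t: "t j \<in> {-1..1}" for j
    by (auto simp: t_def intro: order_trans[of _ 0])
  have "inj_on t {..<n}"
    by (auto simp: inj_on_def t_def)
  then obtain b where b: "\<And>j. j < n \<Longrightarrow> degree (b j) < n"
      "\<And>f. degree f < n \<Longrightarrow> f = (\<Sum>j<n. Polynomial.smult (poly f (t j)) (b j))"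
    using ex_lagrange_basis[of t n] by auto
  define F where "F a = (\<Sum>j<n. Polynomial.smult (a j) (b j))" for a
  \<comment> \<open>The pointwise bounds on \<open>F a\<close> are closed conditions on
    \<open>a\<close>, so \<open>K\<close> is a closed part of the cube.\<close>
  define K where "K = (\<Pi>\<^sub>E j\<in>UNIV. {-1..1}) \<inter> {a. \<forall>x\<in>{-1..1}. \<bar>poly (F a) x\<bar> \<le> 1}"
  have coord: "continuous_on UNIV (\<lambda>a::nat \<Rightarrow> real. a j)" for j
    by simp
  have "compactin (product_topology (\<lambda>_::nat. euclidean) UNIV) (\<Pi>\<^sub>E j\<in>UNIV. {-1..1::real})"
    by (simp add: compactin_PiE)
  then have "compact (\<Pi>\<^sub>E j\<in>(UNIV::nat set). {-1..1::real})"
    by (simp add: euclidean_product_topology)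
  moreover have "closed {a. \<forall>x\<in>{-1..1}. \<bar>poly (F a) x\<bar> \<le> 1}"
    unfolding Ball_def
    by (intro closed_Collect_all closed_Collect_imp closed_Collect_le)
      (auto simp: F_def poly_sum intro!: continuous_intros coord)
  ultimately have "compact K"
    unfolding K_def by (rule compact_Int_closed)
  moreover have "continuous_on K (\<lambda>a. \<Sum>j<n. a j *\<^sub>R \<Phi> (b j))"
    by (intro continuous_intros continuous_on_subset[OF coord]) auto
  ultimately have "compact ((\<lambda>a. \<Sum>j<n. a j *\<^sub>R \<Phi> (b j)) ` K)"
    by (intro compact_continuous_image)
  moreover have "(\<Sum>j<n. a j *\<^sub>R \<Phi> (b j)) = \<Phi> (F a)" for a
    by (simp add: F_def sum scale)
  moreover have "F ` K = model_set n"
  proof (intro equalityI subsetI)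
    fix f assume "f \<in> F ` K"
    then show "f \<in> model_set n"
      using b(1) \<open>n \<ge> 1\<close> le_less_trans[OF degree_smult_le]
      by (auto simp: model_set_iff K_def F_def intro!: degree_sum_less)
  next
    fix f assume f: "f \<in> model_set n"
    then have "F (\<lambda>j. poly f (t j)) = f"
      using b(2)[of f] by (simp add: F_def model_set_iff)
    moreover from this have "(\<lambda>j. poly f (t j)) \<in> K"
      using f t by (auto simp: K_def model_set_iff abs_le_iff)
    ultimately show "f \<in> F ` K"
      by (metis imageI)
  qed
  ultimately show ?thesis
    by (simp add: image_image flip: \<open>F ` K = model_set n\<close>)
qed

lemma convex_image_model_set:
  fixes \<Phi> :: "real poly \<Rightarrow> 'a::real_vector"
  assumes add: "\<And>p q. \<Phi> (p + q) = \<Phi> p + \<Phi> q"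
    and scale: "\<And>c p. \<Phi> (Polynomial.smult c p) = c *\<^sub>R \<Phi> p"
  shows "convex (\<Phi> ` model_set n)"
proof (rule convexI, elim imageE)
  fix a b f g and u v :: real
  assume fg: "f \<in> model_set n" "g \<in> model_set n" and a: "a = \<Phi> f" and b: "b = \<Phi> g"
    and uv: "0 \<le> u" "0 \<le> v" "u + v = 1"
  have "\<bar>u * poly f x + v * poly g x\<bar> \<le> 1" if "x \<in> {-1..1}" for x
  proof -
    have "\<bar>u * poly f x + v * poly g x\<bar> \<le> u * \<bar>poly f x\<bar> + v * \<bar>poly g x\<bar>"
      using uv by (metis abs_mult abs_of_nonneg abs_triangle_ineq)
    also have "\<dots> \<le> 1"
      using fg that uv by (intro convex_bound_le) (auto simp: model_set_iff)
    finally show ?thesis .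
  qed
  then have "Polynomial.smult u f + Polynomial.smult v g \<in> model_set n"
    using fg by (auto simp: model_set_iff intro!: degree_add_less le_less_trans[OF degree_smult_le])
  moreover have "u *\<^sub>R a + v *\<^sub>R b = \<Phi> (Polynomial.smult u f + Polynomial.smult v g)"
    by (simp add: add scale a b)
  ultimately show "u *\<^sub>R a + v *\<^sub>R b \<in> \<Phi> ` model_set n"
    by blast
qed

lemma infnorm_le_iff_cart:
  fixes z :: "real ^ 'n::finite"
  shows "infnorm z \<le> b \<longleftrightarrow> (\<forall>i. \<bar>z $ i\<bar> \<le> b)"
proof
  show "\<forall>i. \<bar>z $ i\<bar> \<le> b" if "infnorm z \<le> b"
    using that component_le_infnorm_cart order_trans by blast
  show "infnorm z \<le> b" if "\<forall>i. \<bar>z $ i\<bar> \<le> b"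
    unfolding infnorm_cart using that by (intro cSup_least) auto
qed

text \<open>The data-consistent set need not have interior, so multipliers attaining the bound \<open>M\<close> itself
  may not exist; strict separation gives them for every \<open>M' > M\<close>.\<close>

lemma ex_multiplier:
  fixes l :: "'m::finite \<Rightarrow> real poly \<Rightarrow> real" and y :: "real ^ 'm"
  assumes l: "\<And>i. linear_form (l i)" and \<phi>: "linear_form \<phi>" and "n \<ge> 1" "\<eta> \<ge> 0"
    and f\<^sub>0: "f\<^sub>0 \<in> model_set n" "\<forall>i. \<bar>y $ i - l i f\<^sub>0\<bar> \<le> \<eta>"
    and bound: "\<And>f. f \<in> model_set n \<Longrightarrow> \<forall>i. \<bar>y $ i - l i f\<bar> \<le> \<eta> \<Longrightarrow> \<phi> f \<le> M"
    and "M < M'"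
  shows "\<exists>c::real ^ 'm. \<forall>f\<in>model_set n.
    \<phi> f - (\<Sum>i\<in>UNIV. c $ i * l i f) + \<eta> * (\<Sum>i\<in>UNIV. \<bar>c $ i\<bar>) + inner c y \<le> M'"
proof -
  define \<Phi> :: "real poly \<Rightarrow> (real ^ 'm) \<times> real" where "\<Phi> f = ((\<chi> i. l i f), \<phi> f)" for f
  have \<Phi>: "\<Phi> (p + q) = \<Phi> p + \<Phi> q" "\<Phi> (Polynomial.smult c p) = c *\<^sub>R \<Phi> p" for p q c
    using l \<phi> by (simp_all add: \<Phi>_def linear_form_simps Finite_Cartesian_Product.vec_eq_iff)
  define E :: "(real ^ 'm) set" where "E = cbox (\<chi> i. - \<eta>) (\<chi> i. \<eta>)"
  have "\<bar>t\<bar> \<le> \<eta> \<longleftrightarrow> - \<eta> \<le> t \<and> t \<le> \<eta>" for t :: real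
    by auto
  then have E: "e \<in> E \<longleftrightarrow> (\<forall>i. \<bar>e $ i\<bar> \<le> \<eta>)" for e
    by (simp add: E_def mem_box_cart)
  \<comment> \<open>All attainable pairs of a noisy observation and a value of
    \<open>\<phi>\<close>; the bound \<open>M\<close> keeps \<open>(y, M')\<close> out of
    it.\<close>
  define D where "D = (\<Union>a\<in>\<Phi> ` model_set n. \<Union>b\<in>E \<times> {0}. {a + b})"
  have D: "\<Phi> f + (e, 0) \<in> D" if "f \<in> model_set n" "e \<in> E" for f e
    using that by (auto simp: D_def)
  have "closed D"
    unfolding D_def E_def using \<Phi> \<open>n \<ge> 1\<close>
    by (intro compact_imp_closed compact_sums' compact_image_model_set compact_Times) auto
  moreover have "convex D"
    unfolding D_def E_def using \<Phi>
    by (intro convex_sums convex_image_model_set convex_Times) auto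
  moreover have "(y, M') \<notin> D"
  proof
    assume "(y, M') \<in> D"
    then obtain f e where f: "f \<in> model_set n" "e \<in> E" "y = (\<chi> i. l i f) + e" "M' = \<phi> f"
      by (auto simp: D_def \<Phi>_def)
    then have "\<phi> f \<le> M"
      by (intro bound) (auto simp: E)
    then show False
      using \<open>M < M'\<close> f(4) by simp
  qed
  ultimately obtain s \<beta> where sep: "inner s (y, M') < \<beta>" "\<forall>d\<in>D. inner s d > \<beta>"
    using separating_hyperplane_closed_point by blast
  obtain a \<alpha> where s: "s = (a, \<alpha>)"
    by (cases s)
  have sep': "inner a y + \<alpha> * M' < inner a ((\<chi> i. l i f) + e) + \<alpha> * \<phi> f"
    if "f \<in> model_set n" "e \<in> E" for f e
    using sep(1) sep(2)[rule_format, OF D[OF that]] by (simp add: s \<Phi>_def)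
  \<comment> \<open>The consistent \<open>f\<^sub>0\<close> gives a point of \<open>D\<close>
    directly below \<open>(y, M')\<close>, so the separating hyperplane is not vertical.\<close>
  have "y - (\<chi> i. l i f\<^sub>0) \<in> E"
    using f\<^sub>0(2) by (simp add: E)
  from sep'[OF f\<^sub>0(1) this] have "0 < \<alpha> * (\<phi> f\<^sub>0 - M')"
    by (simp add: algebra_simps)
  moreover have "\<phi> f\<^sub>0 - M' < 0"
    using bound[OF f\<^sub>0] \<open>M < M'\<close> by simp
  ultimately have \<alpha>: "\<alpha> < 0"
    by (simp add: zero_less_mult_iff)
  define c where "c = (- 1 / \<alpha>) *\<^sub>R a"
  \<comment> \<open>The noise minimising the inner product with \<open>c\<close>: the max-norm ball
    produces the l1 norm of \<open>c\<close>.\<close>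
  define e :: "real ^ 'm" where "e = (\<chi> i. - \<eta> * sgn (c $ i))"
  have "e \<in> E"
    using \<open>\<eta> \<ge> 0\<close> by (auto simp: E e_def abs_mult sgn_if)
  have "c $ i * e $ i = - (\<eta> * \<bar>c $ i\<bar>)" for i
    by (simp add: e_def abs_sgn mult_ac)
  then have ce: "inner c e = - \<eta> * (\<Sum>i\<in>UNIV. \<bar>c $ i\<bar>)"
    by (simp add: inner_vec_def sum_distrib_left sum_negf)
  have "\<phi> f - (\<Sum>i\<in>UNIV. c $ i * l i f) + \<eta> * (\<Sum>i\<in>UNIV. \<bar>c $ i\<bar>) + inner c y \<le> M'"
    if "f \<in> model_set n" for f
  proof -
    have a: "a = (- \<alpha>) *\<^sub>R c"
      using \<alpha> by (simp add: c_def)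
    have "(- \<alpha>) * (inner c y - M') < (- \<alpha>) * (inner c ((\<chi> i. l i f) + e) - \<phi> f)"
      using sep'[OF that \<open>e \<in> E\<close>] unfolding a inner_scaleR_left by (simp add: algebra_simps)
    then have "inner c y - M' < inner c ((\<chi> i. l i f) + e) - \<phi> f"
      using \<alpha> by (simp add: mult_less_cancel_left)
    then show ?thesis
      using ce by (simp add: inner_add_right) (simp add: inner_vec_def)
  qed
  then show ?thesis by blast
qed

text \<open>Apply the nonnegative forms \<mu> - \<psi> to 1 + f and \<mu> + \<psi> to 1 - f, and
  add.\<close>

lemma linear_form_le_if_psd:
  assumes \<mu>: "linear_form \<mu>" and \<psi>: "linear_form \<psi>" and "f \<in> model_set n"
    and "psd_mat (toep (vec n (\<lambda>j. \<mu> (cheb_T j) - \<psi> (cheb_T j))))"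
    and "psd_mat (toep (vec n (\<lambda>j. \<mu> (cheb_T j) + \<psi> (cheb_T j))))"
  shows "\<psi> f \<le> \<mu> 1"
proof -
  have f: "degree f < n" "\<forall>x\<in>{-1..1}. \<bar>poly f x\<bar> \<le> 1"
    using assms(3) by (auto simp: model_set_iff)
  have forms: "linear_form (\<lambda>p. \<mu> p - \<psi> p)" "linear_form (\<lambda>p. \<mu> p + \<psi> p)"
    using \<mu> \<psi> by (auto simp: linear_form_def algebra_simps)
  have "1 + f \<in> poly_space n" "1 - f \<in> poly_space n"
    using f(1) by (auto simp: poly_space_def intro!: degree_add_less degree_diff_less)
  moreover have "nonneg_on_interval (1 + f)" "nonneg_on_interval (1 - f)"
    using f(2) by (force simp: nonneg_on_interval_def abs_le_iff)+
  ultimately have "0 \<le> \<mu> (1 + f) - \<psi> (1 + f)" "0 \<le> \<mu> (1 - f) + \<psi> (1 - f)"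
    using assms(4,5) f(1) psd_toep_cheb_iff[OF forms(1), of n] psd_toep_cheb_iff[OF forms(2), of n]
    by auto
  then show ?thesis
    using \<mu> \<psi> by (simp add: linear_form_simps)
qed

section \<open>Weak and strong duality for the semidefinite program\<close>

lemma toep_minus_toep:
  "toep (vec n a) - toep (vec n b) = toep (vec n (\<lambda>j. a j - b j))"
  "toep (vec n a) - (- toep (vec n b)) = toep (vec n (\<lambda>j. a j + b j))"
  by (auto simp: toep_def intro!: eq_matI)

lemma sdp_matrix_toep:
  "sdp_matrix n (\<lambda>i. toep (vec n (a i))) (\<lambda>k. toep (vec n (c k))) s k u v
    = toep (vec n (\<lambda>j. sign_val s * c k j + (\<Sum>i\<in>UNIV. (v - u) $ i * a i j)))"
  by (auto simp: sdp_matrix_def mat_lincomb_def toep_def intro!: eq_matI)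

text \<open>Weak duality: \<open>u\<close> and \<open>v\<close> are multipliers for the upper and
  lower data constraints on \<open>f\<close>, and \<open>x\<close> encodes a form dominating the
  resulting Lagrangian form \<open>\<psi>\<close>.\<close>

lemma sdp_feasible_bound:
  fixes l :: "'m::finite \<Rightarrow> real poly \<Rightarrow> real" and q :: "'k::finite \<Rightarrow> real poly \<Rightarrow> real"
  assumes l: "\<And>i. linear_form (l i)" and q: "\<And>k. linear_form (q k)"
    and feas: "sdp_feasible n \<eta> (\<lambda>i. toep (vec n (\<lambda>j. l i (cheb_T j))))
      (\<lambda>k. toep (vec n (\<lambda>j. q k (cheb_T j)))) y z r x u v"
    and f: "f \<in> model_set n" "\<forall>i. \<bar>y $ i - l i f\<bar> \<le> \<eta>"
  shows "sign_val s * q k f \<le> r + sign_val s * z $ k"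
proof -
  define \<psi> where "\<psi> p = sign_val s * q k p + (\<Sum>i\<in>UNIV. (v s k - u s k) $ i * l i p)" for p
  have \<psi>: "linear_form \<psi>"
    unfolding \<psi>_def by (intro linear_form_combination l q)
  obtain \<mu> where \<mu>: "linear_form \<mu>" "\<And>j. j < n \<Longrightarrow> \<mu> (cheb_T j) = vec_index (x s k) j"
    using ex_linear_form_cheb_T[of n "vec_index (x s k)"] by blast
  have "x s k \<in> carrier_vec n"
    using feas by (simp add: sdp_feasible_def)
  then have x: "x s k = vec n (\<lambda>j. \<mu> (cheb_T j))"
    using \<mu>(2) by (intro eq_vecI) auto
  have sdp: "sdp_matrix n (\<lambda>i. toep (vec n (\<lambda>j. l i (cheb_T j))))
      (\<lambda>k. toep (vec n (\<lambda>j. q k (cheb_T j)))) s k (u s k) (v s k)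
    = toep (vec n (\<lambda>j. \<psi> (cheb_T j)))"
    by (simp only: sdp_matrix_toep \<psi>_def)
  have feas':
    "vec_index (x s k) 0 + inner (u s k) (\<chi> i. y $ i + \<eta>) - inner (v s k) (\<chi> i. y $ i - \<eta>)
        \<le> r + sign_val s * z $ k"
    "0 \<le> u s k" "0 \<le> v s k"
    "psd_mat (toep (vec n (\<lambda>j. \<mu> (cheb_T j) - \<psi> (cheb_T j))))"
    "psd_mat (toep (vec n (\<lambda>j. \<mu> (cheb_T j) + \<psi> (cheb_T j))))"
    unfolding toep_minus_toep[symmetric] sdp[symmetric] x[symmetric]
    using feas unfolding sdp_feasible_def by blast+
  \<comment> \<open>Component 0 of \<open>x\<close> thus exists; it is the value of
    \<open>\<mu>\<close> at \<open>cheb_T 0 = 1\<close>.\<close>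
  have "n > 0"
    using f(1) by (auto simp: model_set_iff)
  then have "\<psi> f \<le> vec_index (x s k) 0"
    using linear_form_le_if_psd[OF \<mu>(1) \<psi> f(1) feas'(4,5)] \<mu>(2)[of 0] by simp
  moreover have yl: "l i f \<le> y $ i + \<eta>" "y $ i - \<eta> \<le> l i f" for i
    using f(2)[rule_format, of i] by (auto simp: abs_le_iff)
  have "(\<Sum>i\<in>UNIV. u s k $ i * l i f) \<le> inner (u s k) (\<chi> i. y $ i + \<eta>)"
    unfolding inner_vec_def using feas'(2) yl(1)
    by (auto simp: Finite_Cartesian_Product.less_eq_vec_def intro!: sum_mono mult_left_mono)
  moreover have "inner (v s k) (\<chi> i. y $ i - \<eta>) \<le> (\<Sum>i\<in>UNIV. v s k $ i * l i f)"
    unfolding inner_vec_def using feas'(3) yl(2)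
    by (auto simp: Finite_Cartesian_Product.less_eq_vec_def intro!: sum_mono mult_left_mono)
  moreover have "\<psi> f = sign_val s * q k f + (\<Sum>i\<in>UNIV. v s k $ i * l i f) - (\<Sum>i\<in>UNIV. u s k $ i * l i f)"
    by (simp add: \<psi>_def left_diff_distrib sum_subtractf)
  ultimately show ?thesis
    using feas'(1) by simp
qed

text \<open>Strong duality up to \<open>\<epsilon>\<close>: for fixed \<open>w\<close> and
  \<open>\<rho>\<close> the constraints decouple over signs and components, and each block comes
  from a multiplier and a dominating form.\<close>

lemma ex_sdp_feasible:
  fixes l :: "'m::finite \<Rightarrow> real poly \<Rightarrow> real" and q :: "'k::finite \<Rightarrow> real poly \<Rightarrow> real"
  assumes l: "\<And>i. linear_form (l i)" and q: "\<And>k. linear_form (q k)" and "n \<ge> 1" "\<eta> \<ge> 0" "\<epsilon> > 0"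
    and f\<^sub>0: "f\<^sub>0 \<in> model_set n" "\<forall>i. \<bar>y $ i - l i f\<^sub>0\<bar> \<le> \<eta>"
    and bound: "\<And>f s k. f \<in> model_set n \<Longrightarrow> \<forall>i. \<bar>y $ i - l i f\<bar> \<le> \<eta> \<Longrightarrow>
      sign_val s * q k f \<le> \<rho> + sign_val s * w $ k"
  shows "\<exists>x u v. sdp_feasible n \<eta> (\<lambda>i. toep (vec n (\<lambda>j. l i (cheb_T j))))
      (\<lambda>k. toep (vec n (\<lambda>j. q k (cheb_T j)))) y w (\<rho> + \<epsilon>) x u v"
proof -
  define P where "P s k x u v \<longleftrightarrow> x \<in> carrier_vec n \<and>
      vec_index x 0 + inner u (\<chi> i. y $ i + \<eta>) - inner v (\<chi> i. y $ i - \<eta>)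
        \<le> \<rho> + \<epsilon> + sign_val s * w $ k \<and> 0 \<le> u \<and> 0 \<le> v \<and>
      psd_mat (toep x - sdp_matrix n (\<lambda>i. toep (vec n (\<lambda>j. l i (cheb_T j))))
        (\<lambda>k. toep (vec n (\<lambda>j. q k (cheb_T j)))) s k u v) \<and>
      psd_mat (toep x - (- sdp_matrix n (\<lambda>i. toep (vec n (\<lambda>j. l i (cheb_T j))))
        (\<lambda>k. toep (vec n (\<lambda>j. q k (cheb_T j)))) s k u v))" for s k x u v
  have "\<exists>x u v. P s k x u v" for s k
  proof -
    define \<phi> where "\<phi> p = sign_val s * q k p" for p
    have \<phi>: "linear_form \<phi>"
      using q[of k] by (simp add: linear_form_def \<phi>_def algebra_simps)
    define M' where "M' = \<rho> + sign_val s * w $ k + \<epsilon>"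
    obtain c :: "real ^ 'm" where c: "\<forall>f\<in>model_set n.
        \<phi> f - (\<Sum>i\<in>UNIV. c $ i * l i f) + \<eta> * (\<Sum>i\<in>UNIV. \<bar>c $ i\<bar>) + inner c y \<le> M'"
      using ex_multiplier[of l \<phi> n \<eta> f\<^sub>0 y "\<rho> + sign_val s * w $ k" M'] assms(3-) l \<phi>
      unfolding \<phi>_def M'_def by auto
    \<comment> \<open>Positive and negative parts of \<open>c\<close>: their difference yields the
      term \<open>inner c y\<close>, their sum the l1 term.\<close>
    define u v :: "real ^ 'm" where "u = (\<chi> i. max (c $ i) 0)" and "v = (\<chi> i. max (- c $ i) 0)"
    have vu: "v - u = - c"
      by (auto simp: u_def v_def Finite_Cartesian_Product.vec_eq_iff)
    define \<psi> where "\<psi> p = sign_val s * q k p + (\<Sum>i\<in>UNIV. (v - u) $ i * l i p)" for p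
    define N where "N = M' - \<eta> * (\<Sum>i\<in>UNIV. \<bar>c $ i\<bar>) - inner c y"
    have \<psi>: "linear_form \<psi>"
      unfolding \<psi>_def by (intro linear_form_combination l q)
    moreover have "\<forall>f\<in>model_set n. \<psi> f \<le> N"
      using c by (simp add: \<psi>_def vu N_def \<phi>_def sum_negf algebra_simps)
    ultimately obtain \<mu> where \<mu>: "linear_form \<mu>" "\<mu> 1 = N"
        "\<forall>f\<in>poly_space n. nonneg_on_interval f \<longrightarrow> \<bar>\<psi> f\<bar> \<le> \<mu> f"
      using ex_dominating_form \<open>n \<ge> 1\<close> by blast
    have forms: "linear_form (\<lambda>p. \<mu> p - \<psi> p)" "linear_form (\<lambda>p. \<mu> p + \<psi> p)"
      using \<mu>(1) \<psi> by (auto simp: linear_form_def algebra_simps)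
    have "psd_mat (toep (vec n (\<lambda>j. \<mu> (cheb_T j) - \<psi> (cheb_T j))))"
      "psd_mat (toep (vec n (\<lambda>j. \<mu> (cheb_T j) + \<psi> (cheb_T j))))"
      using \<mu>(3) \<open>n \<ge> 1\<close> by (force simp: psd_toep_cheb_iff[OF forms(1)] psd_toep_cheb_iff[OF forms(2)])+
    moreover have "N + inner u (\<chi> i. y $ i + \<eta>) - inner v (\<chi> i. y $ i - \<eta>) = M'"
    proof -
      have "inner u (\<chi> i. y $ i + \<eta>) - inner v (\<chi> i. y $ i - \<eta>)
          = (\<Sum>i\<in>UNIV. c $ i * y $ i + \<eta> * \<bar>c $ i\<bar>)"
        unfolding inner_vec_def sum_subtractf[symmetric]
        by (intro sum.cong) (auto simp: u_def v_def max_def algebra_simps)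
      also have "\<dots> = inner c y + \<eta> * (\<Sum>i\<in>UNIV. \<bar>c $ i\<bar>)"
        by (simp add: inner_vec_def sum.distrib sum_distrib_left)
      finally show ?thesis
        by (simp add: N_def)
    qed
    moreover have "0 \<le> u" "0 \<le> v"
      by (simp_all add: u_def v_def Finite_Cartesian_Product.less_eq_vec_def)
    ultimately show ?thesis
      using \<mu>(2) \<open>n \<ge> 1\<close>
      by (intro exI[of _ "vec n (\<lambda>j. \<mu> (cheb_T j))"] exI[of _ u] exI[of _ v])
        (simp add: P_def sdp_matrix_toep toep_minus_toep \<psi>_def M'_def)
  qed
  \<comment> \<open>Pairing indices and witnesses lets one choice select all blocks at once.\<close>
  then have "\<forall>sk. \<exists>xuv. P (fst sk) (snd sk) (fst xuv) (fst (snd xuv)) (snd (snd xuv))"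
    by simp
  from choice[OF this] obtain W where
    W: "\<forall>sk. P (fst sk) (snd sk) (fst (W sk)) (fst (snd (W sk))) (snd (snd (W sk)))" ..
  have "P s k (fst (W (s, k))) (fst (snd (W (s, k)))) (snd (snd (W (s, k))))" for s k
    using spec[OF W, of "(s, k)"] by simp
  then have "sdp_feasible n \<eta> (\<lambda>i. toep (vec n (\<lambda>j. l i (cheb_T j))))
      (\<lambda>k. toep (vec n (\<lambda>j. q k (cheb_T j)))) y w (\<rho> + \<epsilon>) (\<lambda>s k. fst (W (s, k)))
      (\<lambda>s k. fst (snd (W (s, k)))) (\<lambda>s k. snd (snd (W (s, k))))"
    unfolding sdp_feasible_def P_def by blast
  then show ?thesis by blast
qed

text \<open>A max-norm bound splits into one linear inequality per sign and component, matching the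
  blocks of the program.\<close>

lemma worst_case_error_le_iff:
  fixes L :: "real poly \<Rightarrow> real ^ 'm::finite" and Q :: "real poly \<Rightarrow> real ^ 'k::finite"
  shows "worst_case_error infnorm (model_set n) (uncertainty_set \<eta>) L Q y w \<le> ereal \<rho> \<longleftrightarrow>
    (\<forall>f\<in>model_set n. (\<forall>i. \<bar>y $ i - L f $ i\<bar> \<le> \<eta>) \<longrightarrow>
      (\<forall>s k. sign_val s * Q f $ k \<le> \<rho> + sign_val s * w $ k))"
proof -
  have sign: "(\<forall>s. sign_val s * a \<le> \<rho> + sign_val s * b) \<longleftrightarrow> \<bar>a - b\<bar> \<le> \<rho>" for a b
  proof
    assume "\<forall>s. sign_val s * a \<le> \<rho> + sign_val s * b"
    from this[rule_format, of Pos] this[rule_format, of Neg] show "\<bar>a - b\<bar> \<le> \<rho>"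
      by simp
  next
    assume h: "\<bar>a - b\<bar> \<le> \<rho>"
    show "\<forall>s. sign_val s * a \<le> \<rho> + sign_val s * b"
    proof
      fix s show "sign_val s * a \<le> \<rho> + sign_val s * b"
        using h by (cases s) auto
    qed
  qed
  have *: "L f + e = y \<longleftrightarrow> e = y - L f" for f e
    by (auto simp: algebra_simps)
  show ?thesis
    unfolding worst_case_error_def SUP_le_iff
    by (auto simp: * uncertainty_set_def infnorm_le_iff_cart simp flip: sign)
qed

theorem theorem3:
  fixes n :: nat and \<eta> :: real
    and l :: "'m::finite \<Rightarrow> real poly \<Rightarrow> real"
    and q :: "'k::finite \<Rightarrow> real poly \<Rightarrow> real"
    and L :: "real poly \<Rightarrow> real ^ 'm"
    and Q :: "real poly \<Rightarrow> real ^ 'k"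
    and A :: "'m \<Rightarrow> real mat"
    and C :: "'k \<Rightarrow> real mat"
    and R :: "real ^ 'm \<Rightarrow> real ^ 'k"
  assumes "n \<ge> 1" and "\<eta> \<ge> 0"
    and "\<And>i. linear_functional_on_polys n (l i)"
    and "\<And>k. linear_functional_on_polys n (q k)"
    and "L = (\<lambda>f. \<chi> i. l i f)"
    and "Q = (\<lambda>f. \<chi> k. q k f)"
    and "A = (\<lambda>i. toep (vec n (\<lambda>j. l i (cheb_T j))))"
    and "C = (\<lambda>k. toep (vec n (\<lambda>j. q k (cheb_T j))))"
  shows "\<forall>y \<in> {L f + e | f e. f \<in> model_set n \<and> e \<in> uncertainty_set \<eta>}.
           sdp_solution n \<eta> A C y (R y) \<longrightarrow>
           locally_optimal_at infnorm (model_set n) (uncertainty_set \<eta>) L Q R y"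
proof (intro ballI impI)
  fix y assume "y \<in> {L f + e | f e. f \<in> model_set n \<and> e \<in> uncertainty_set \<eta>}"
  then obtain f\<^sub>0 where f\<^sub>0: "f\<^sub>0 \<in> model_set n" "\<forall>i. \<bar>y $ i - L f\<^sub>0 $ i\<bar> \<le> \<eta>"
    by (auto simp: uncertainty_set_def infnorm_le_iff_cart)
  assume "sdp_solution n \<eta> A C y (R y)"
  then obtain r x u v where feas: "sdp_feasible n \<eta> A C y (R y) r x u v"
    and opt: "\<And>z' r' x' u' v'. sdp_feasible n \<eta> A C y z' r' x' u' v' \<Longrightarrow> r \<le> r'"
    unfolding sdp_solution_def by blast
  obtain l' where l': "\<And>i. linear_form (l' i)" "\<And>i p. p \<in> poly_space n \<Longrightarrow> l' i p = l i p"
    using linear_functional_extends[OF assms(3,1)] by metis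
  obtain q' where q': "\<And>k. linear_form (q' k)" "\<And>k p. p \<in> poly_space n \<Longrightarrow> q' k p = q k p"
    using linear_functional_extends[OF assms(4,1)] by metis
  \<comment> \<open>The matrices involve only Chebyshev polynomials of degree below
    \<open>n\<close>, so extending the functionals leaves them unchanged.\<close>
  have "cheb_T j \<in> poly_space n" if "j < n" for j
    using that by (simp add: poly_space_def degree_cheb_T)
  then have A: "A = (\<lambda>i. toep (vec n (\<lambda>j. l' i (cheb_T j))))"
    and C: "C = (\<lambda>k. toep (vec n (\<lambda>j. q' k (cheb_T j))))"
    using l'(2) q'(2) unfolding assms(7,8)
    by (auto intro!: arg_cong[of _ _ toep] eq_vecI)
  have LQ: "L f $ i = l' i f" "Q f $ k = q' k f" if "f \<in> model_set n" for f i k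
    using that l'(2) q'(2) by (simp_all add: assms(5,6) model_set_def)
  let ?err = "worst_case_error infnorm (model_set n) (uncertainty_set \<eta>) L Q y"
  have "?err (R y) \<le> ereal r"
    unfolding worst_case_error_le_iff
    using sdp_feasible_bound[OF l'(1) q'(1) feas[unfolded A C]] by (simp add: LQ)
  \<comment> \<open>Comparison with real upper bounds also covers an infinite error, where there are
    none.\<close>
  moreover have "ereal r \<le> ?err w" for w
  proof (rule ereal_le_real)
    fix \<rho> assume "?err w \<le> ereal \<rho>"
    then have bound: "sign_val s * q' k f \<le> \<rho> + sign_val s * w $ k"
      if "f \<in> model_set n" "\<forall>i. \<bar>y $ i - l' i f\<bar> \<le> \<eta>" for f s k
      using that unfolding worst_case_error_le_iff by (simp add: LQ)
    \<comment> \<open>Any competitor \<open>w\<close> is feasible as the z-component with objective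
      \<open>\<rho> + \<epsilon>\<close>, so optimality of \<open>r\<close> over all z
      applies.\<close>
    have "r \<le> \<rho> + \<epsilon>" if "\<epsilon> > 0" for \<epsilon>
    proof -
      have "\<exists>x u v. sdp_feasible n \<eta> A C y w (\<rho> + \<epsilon>) x u v"
        unfolding A C using l'(1) q'(1) assms(1,2) that f\<^sub>0 bound
        by (intro ex_sdp_feasible[of l' q' n \<eta> \<epsilon> f\<^sub>0 y \<rho> w]) (auto simp: LQ)
      then show ?thesis
        using opt by blast
    qed
    then have "r \<le> \<rho>"
      by (rule field_le_epsilon)
    then show "ereal r \<le> ereal \<rho>"
      by simp
  qed
  ultimately show "locally_optimal_at infnorm (model_set n) (uncertainty_set \<eta>) L Q R y"
    unfolding locally_optimal_at_def
    by (intro antisym INF_greatest INF_lower) (auto intro: order_trans)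
qed

end
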